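(* Let $H:\mathbb N\to\mathbb N$ be defined by $H(0)=0$ and $H(i)=i-H(H(H(i-1)))$ for $i\ge1$. Let $(A(n))_{n\ge1}$ be the increasing enumeration of the natural numbers that occur exactly twice among the values $H(0),H(1),H(2),\dots$ (so $A=1,4,5,7,10,\dots$), and let $(B(n))_{n\ge1}$ be the increasing enumeration of the positive integers whose Narayana representation ends in the digit $1$ (so $B=1,5,7,10,14,\dots$). Then $A(n)+n-1=B(n)$ for all $n\ge1$.
   Context: The Narayana numbers are defined by $N_0=1$, $N_1=2$, $N_2=3$, $N_i=N_{i-1}+N_{i-3}$ for $i\ge3$. The Narayana representation of a positive integer $m$ is the unique binary word $e_1\cdots e_t$ with $e_1=1$, no factor $11$ or $101$, and $m=\sum_{i=1}^t e_iN_{t-i}$. *)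

theory Defs
  imports "HOL-Library.Infinite_Set" "HOL-Library.Sublist"
begin

function (domintros) H :: "nat \<Rightarrow> nat" where
  "H 0 = 0"
| "H (Suc i) = Suc i - H (H (H i))"
  by pat_completeness auto

lemma H_dom_le: "H_dom n \<Longrightarrow> H n \<le> n"
  by (induction rule: H.pinduct) (simp_all add: H.psimps)

termination
proof (relation "measure id")
  fix i assume "H_dom i"
  then show "(H i, Suc i) \<in> measure id"
    using H_dom_le[of i] by simp
next
  fix i assume i: "H_dom i" and Hi: "H_dom (H i)"
  then show "(H (H i), Suc i) \<in> measure id"
    using H_dom_le[OF i] H_dom_le[OF Hi] by simp
qed auto

lemma H_le: "H n \<le> n"
  by (induction n) simp_all

text \<open>The subtraction in the recursion is never truncated.\<close>

lemma H_rec: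
  assumes "i \<ge> 1"
  shows "int (H i) = int i - int (H (H (H (i - 1))))"
proof -
  obtain j where i: "i = Suc j" using assms by (cases i) auto
  have "H (H (H j)) \<le> j"
    using H_le[of j] H_le[of "H j"] H_le[of "H (H j)"] by linarith
  then show ?thesis by (simp add: i)
qed

fun narayana :: "nat \<Rightarrow> nat" where
  "narayana 0 = 1"
| "narayana (Suc 0) = 2"
| "narayana (Suc (Suc 0)) = 3"
| "narayana (Suc (Suc (Suc i))) = narayana (Suc (Suc i)) + narayana i"

text \<open>Words are lists of digits, most significant digit first; the digit called $e_i$ in the
  literature is \<open>w ! (i - 1)\<close>. Factors are contiguous subwords.\<close>

definition is_narayana_rep :: "nat \<Rightarrow> nat list \<Rightarrow> bool" where
  "is_narayana_rep m w \<longleftrightarrow>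
     w \<noteq> [] \<and> set w \<subseteq> {0, 1} \<and> hd w = 1 \<and>
     \<not> sublist [1, 1] w \<and> \<not> sublist [1, 0, 1] w \<and>
     m = (\<Sum>i = 1..length w. w ! (i - 1) * narayana (length w - i))"

definition narayana_rep :: "nat \<Rightarrow> nat list" where
  "narayana_rep m = (THE w. is_narayana_rep m w)"

text \<open>Library enumerations start at index 0, the sequences below at index 1.\<close>

definition A :: "nat \<Rightarrow> nat" where
  "A n = enumerate {k. card {i. H i = k} = 2} (n - 1)"

definition B :: "nat \<Rightarrow> nat" where
  "B n = enumerate {m. m > 0 \<and> last (narayana_rep m) = 1} (n - 1)"

end

theory Submission imports Defs begin

text \<open>
  \<open>H\<close> increases by \<open>0\<close> or \<open>1\<close> at each step, so \<open>i - H i\<close> counts the indices \<open>j < i\<close> with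
  \<open>H (j + 1) = H j\<close>. The values taken twice are the \<open>H i\<close> for such indices \<open>i\<close>; if \<open>i\<close> is the
  \<open>n\<close>-th one, then \<open>A n = H i = i - (n - 1)\<close>. It remains to see that these \<open>i\<close> are
  the numbers whose Narayana representation ends in \<open>1\<close>. This follows, digit by digit, from the
  shift identity \<open>H (N\<^sub>k + r) = N\<^sub>k\<^sub>-\<^sub>1 + H r\<close> for \<open>0 \<le> r \<le> N\<^sub>k\<^sub>-\<^sub>2\<close>.
\<close>

section \<open>The function \<open>H\<close>\<close>

text \<open>By strong induction a step of 0 or 1 survives three applications of \<open>H\<close>;
  the recursion then turns it into a step of 1 or 0.\<close>

lemma H_Suc_cases: "H (Suc i) = H i \<or> H (Suc i) = Suc (H i)"
proof (induction i rule: less_induct)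
  case (less i)
  show ?case
  proof (cases i)
    case 0
    then show ?thesis by simp
  next
    case (Suc j)
    have 1: "H i = H j \<or> H i = Suc (H j)"
      using less Suc by simp
    have 2: "H (H i) = H (H j) \<or> H (H i) = Suc (H (H j))"
      using 1 less[of "H j"] H_le[of j] Suc by fastforce
    have 3: "H (H (H i)) = H (H (H j)) \<or> H (H (H i)) = Suc (H (H (H j)))"
      using 2 less[of "H (H j)"] H_le[of j] H_le[of "H j"] Suc by fastforce
    have "H (H (H j)) \<le> j"
      using H_le[of j] H_le[of "H j"] H_le[of "H (H j)"] by linarith
    then show ?thesis
      using 3 Suc by auto
  qed
qed

lemma mono_H: "mono H"
  unfolding mono_iff_le_Suc
proof
  fix i show "H i \<le> H (Suc i)"
    using H_Suc_cases[of i] by auto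
qed

text \<open>After a repeated value the recursion subtracts the same number once more while its first
  term grows, so no value occurs three times in a row.\<close>

lemma H_Suc_Suc_neq:
  assumes "H (Suc i) = H i"
  shows "H (Suc (Suc i)) \<noteq> H (Suc i)"
proof -
  have "H (H (H i)) \<le> i"
    using H_le[of i] H_le[of "H i"] H_le[of "H (H i)"] by linarith
  then have "H (Suc (Suc i)) = Suc (H (Suc i))"
    using assms by (simp add: Suc_diff_le)
  then show ?thesis by simp
qed

text \<open>For \<open>k = 1\<close> the truncated index \<open>k - 2 = 0\<close> gives the correct value
  \<open>N\<^sub>-\<^sub>1 = N\<^sub>2 - N\<^sub>1 = 1\<close>.\<close>

lemma H_narayana_add:
  assumes "k \<ge> 1" "r \<le> narayana (k - 2)"
  shows "H (narayana k + r) = narayana (k - 1) + H r"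
  using assms
proof (induction k arbitrary: r rule: less_induct)
  case (less k)
  consider "k = 1" | "k = 2" | "k \<ge> 3" using less.prems by linarith
  then show ?case
  proof cases
    case 1
    then have "r = 0 \<or> r = 1" using less.prems by auto
    then show ?thesis using 1 by (auto simp: numeral_eq_Suc)
  next
    case 2
    then have "r = 0 \<or> r = 1" using less.prems by auto
    then show ?thesis using 2 by (auto simp: numeral_eq_Suc)
  next
    case 3
    then obtain l where k: "k = Suc (Suc (Suc l))"
      by (metis add_Suc le_Suc_ex numeral_3_eq_3)
    have step: "H (narayana (Suc j) + s) = narayana j + H s"
      if "s \<le> narayana (j - 1)" "j < Suc (Suc l)" for j s
      using less.IH[of "Suc j" s] that k by simp
    have H_nar: "H (narayana (Suc j)) = narayana j" if "j < Suc (Suc l)" for j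
      using step[of 0 j] that by simp
    have "r \<le> narayana (Suc l)" using less.prems k by simp
    then have "H (narayana k + r) = narayana (Suc (Suc l)) + H r"
    proof (induction r)
      case 0
      \<comment> \<open>Here \<open>narayana k\<close> itself is split by its recurrence;
        \<open>narayana l\<close> is the largest remainder that the shift identity at index
        \<open>k - 1\<close> admits.\<close>
      have "H (narayana (Suc (Suc l)) + narayana l) = narayana (Suc l) + H (narayana l)"
        by (rule step) auto
      moreover have "narayana (Suc l) + H (narayana l) = narayana (Suc (Suc l))"
        proof (cases l)
        case (Suc j)
        then show ?thesis using H_nar[of j] by (simp del: H.simps)
      qed simp
      ultimately show ?case using k by simp
    next
      case (Suc r)
      \<comment> \<open>\<open>narayana k + r\<close> is pushed through \<open>H\<close> three
        times, the index dropping by one each time; \<open>b1\<close> and \<open>b2\<close> keep the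
        remainders in range.\<close>
      have r: "r \<le> narayana (Suc l)" using Suc.prems by simp
      have b1: "H r \<le> narayana l"
        using monoD[OF mono_H r] H_nar[of l] by simp
      have b2: "H (H r) \<le> narayana (l - 1)"
        using monoD[OF mono_H b1] H_nar[of "l - 1"] H_le[of "narayana l"]
        by (cases l) auto
      have "H (narayana k + r) = narayana (Suc (Suc l)) + H r"
        using Suc.IH r by simp
      moreover have "H (narayana (Suc (Suc l)) + H r) = narayana (Suc l) + H (H r)"
        using step[of "H r" "Suc l"] b1 by simp
      moreover have "H (narayana (Suc l) + H (H r)) = narayana l + H (H (H r))"
        using step[of "H (H r)" l] b2 by simp
      \<comment> \<open>Since \<open>narayana k - narayana l = narayana (Suc (Suc l))\<close>, what
        is left besides this term is the recursion for \<open>H (Suc r)\<close>.\<close>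
      ultimately have "H (narayana k + Suc r) = Suc (narayana k + r) - (narayana l + H (H (H r)))"
        by simp
      moreover have "H (H (H r)) \<le> r"
        using H_le[of r] H_le[of "H r"] H_le[of "H (H r)"] by linarith
      ultimately show ?case using k by simp
    qed
    then show ?thesis using k by simp
  qed
qed

section \<open>Narayana representations\<close>

text \<open>Leading zeros are allowed so that tails of words are again words. A digit 1 forces two
  zeros after it unless the word ends first, whence the two short base cases.\<close>

inductive narayana_word :: "nat list \<Rightarrow> bool" where
  Nil: "narayana_word []"
| zero: "narayana_word w \<Longrightarrow> narayana_word (0 # w)"
| one: "narayana_word [1]"
| one_zero: "narayana_word [1, 0]"
| one_zero_zero: "narayana_word w \<Longrightarrow> narayana_word (1 # 0 # 0 # w)"

fun narayana_val :: "nat list \<Rightarrow> nat" where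
  "narayana_val [] = 0"
| "narayana_val (e # w) = e * narayana (length w) + narayana_val w"

lemma narayana_val_eq_sum:
  "(\<Sum>i = 1..length w. w ! (i - 1) * narayana (length w - i)) = narayana_val w"
proof (induction w)
  case (Cons e w)
  have "(\<Sum>i = 1..length (e # w). (e # w) ! (i - 1) * narayana (length (e # w) - i)) =
    (\<Sum>i = 0..length w. (e # w) ! i * narayana (length w - i))"
    using sum.shift_bounds_cl_Suc_ivl[of "\<lambda>i. (e # w) ! (i - 1) * narayana (length (e # w) - i)" 0 "length w"]
    by simp
  also have "\<dots> = e * narayana (length w) +
    (\<Sum>i = 1..length w. w ! (i - 1) * narayana (length w - i))"
    by (simp add: sum.atLeast_Suc_atMost)
  finally show ?case using Cons by simp
qed simp

lemma narayana_word_iff: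
  "narayana_word w \<longleftrightarrow> set w \<subseteq> {0, 1} \<and> \<not> sublist [1, 1] w \<and> \<not> sublist [1, 0, 1] w"
  (is "_ \<longleftrightarrow> ?P w")
proof
  show "narayana_word w \<Longrightarrow> ?P w"
    by (induction rule: narayana_word.induct) (auto simp: sublist_Cons_right)
next
  show "?P w \<Longrightarrow> narayana_word w"
  proof (induction w rule: length_induct)
    case (1 w)
    show ?case
    proof (cases w)
      case Nil
      then show ?thesis by (simp add: narayana_word.Nil)
    next
      case (Cons e u)
      show ?thesis
      proof (cases "e = 0")
        case True
        then show ?thesis
          using 1 Cons by (auto simp: sublist_Cons_right intro: narayana_word.zero)
      next
        case False
        then have e: "e = 1" using 1 Cons by auto
        consider "u = []" | a where "u = [a]" | a b v where "u = a # b # v"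
          by (metis neq_Nil_conv)
        then show ?thesis
        proof cases
          case 1
          then show ?thesis using Cons e narayana_word.one by simp
        next
          case 2
          then have "a = 0" using "1.prems" Cons e by auto
          then show ?thesis using 2 Cons e narayana_word.one_zero by simp
        next
          case 3
          then have a: "a = 0" using "1.prems" Cons e by auto
          then have b: "b = 0" using "1.prems" Cons e 3 by (auto simp: sublist_Cons_right)
          have "narayana_word v"
            using 1 Cons 3 by (auto simp: sublist_Cons_right)
          then show ?thesis using 3 Cons e a b narayana_word.one_zero_zero by simp
        qed
      qed
    qed
  qed
qed

lemma is_narayana_rep_iff:
  "is_narayana_rep m w \<longleftrightarrow> w \<noteq> [] \<and> hd w = 1 \<and> narayana_word w \<and> m = narayana_val w"
  unfolding is_narayana_rep_def narayana_word_iff narayana_val_eq_sum by auto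

lemma narayana_Suc_gt: "narayana k < narayana (Suc k)"
  by (induction k rule: narayana.induct) auto

lemma strict_mono_narayana: "strict_mono narayana"
  by (simp add: strict_mono_Suc_iff narayana_Suc_gt)

text \<open>A leading block 100 before a tail of length \<open>l\<close> contributes
  \<open>narayana (l + 2)\<close>, and
  \<open>narayana (l + 2) + narayana l = narayana (l + 3)\<close>.\<close>

lemma narayana_val_less: "narayana_word w \<Longrightarrow> narayana_val w < narayana (length w)"
proof (induction rule: narayana_word.induct)
  case (zero w)
  then show ?case using narayana_Suc_gt[of "length w"] by simp
qed auto

text \<open>The tail is worth less than the weight of the leading digit, so the value determines
  that digit.\<close>

lemma narayana_word_val_inj:
  assumes "narayana_word u" "narayana_word v" "length u = length v" "narayana_val u = narayana_val v"
  shows "u = v"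
  using assms
proof (induction u arbitrary: v rule: list.induct)
  case Nil
  then show ?case by simp
next
  case (Cons d u)
  then obtain e w where v: "v = e # w" by (cases v) auto
  have tail: "narayana_word w" if "narayana_word (e # w)" for e :: nat and w
    using that by (auto simp: narayana_word_iff sublist_Cons_right)
  have u: "narayana_word u" and w: "narayana_word w"
    using Cons.prems tail v by auto
  have "d \<in> {0, 1}" "e \<in> {0, 1}"
    using Cons.prems v by (auto simp: narayana_word_iff)
  then have "d = e"
    using Cons.prems v narayana_val_less[OF u] narayana_val_less[OF w] by auto
  then show ?case
    using Cons.IH[OF u w] Cons.prems v by simp
qed

text \<open>A leading 1 confines \<open>m\<close> between consecutive Narayana numbers, which fixes
  the length; injectivity at fixed length does the rest.\<close>

lemma is_narayana_rep_unique:
  assumes "is_narayana_rep m u" "is_narayana_rep m v"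
  shows "u = v"
proof -
  have bounds: "narayana (length w - 1) \<le> m \<and> m < narayana (length w) \<and> length w > 0"
    if "is_narayana_rep m w" for w
    using that narayana_val_less[of w] by (cases w) (auto simp: is_narayana_rep_iff)
  have le: "length w \<le> length x" if "is_narayana_rep m w" "is_narayana_rep m x" for w x
  proof -
    have "narayana (length w - 1) < narayana (length x)"
      using bounds[OF that(1)] bounds[OF that(2)] by linarith
    then show ?thesis
      using bounds[OF that(1)] strict_mono_less[OF strict_mono_narayana] by fastforce
  qed
  have "length u = length v"
    using le assms by (simp add: le_antisym)
  then show ?thesis
    using assms by (auto simp: is_narayana_rep_iff intro: narayana_word_val_inj)
qed

text \<open>Greedy expansion, padded with zeros to length \<open>t\<close>: subtracting the largest
  weight leaves a remainder small enough for two zeros to follow.\<close>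

lemma narayana_word_exists:
  "m < narayana t \<Longrightarrow> \<exists>w. narayana_word w \<and> length w = t \<and> narayana_val w = m"
proof (induction t arbitrary: m rule: less_induct)
  case (less t)
  show ?case
  proof (cases t)
    case 0
    then show ?thesis using less.prems narayana_word.Nil by auto
  next
    case (Suc s)
    show ?thesis
    proof (cases "m < narayana s")
      case True
      then obtain w where "narayana_word w" "length w = s" "narayana_val w = m"
        using less.IH Suc by blast
      then show ?thesis
        using Suc by (intro exI[of _ "0 # w"]) (auto intro: narayana_word.zero)
    next
      case False
      consider "s = 0" | "s = 1" | l where "s = Suc (Suc l)"
        by (metis One_nat_def not0_implies_Suc)
      then show ?thesis
      proof cases
        case 1
        then show ?thesis
          using False less.prems Suc narayana_word.one by (intro exI[of _ "[1]"]) auto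
      next
        case 2
        then show ?thesis
          using False less.prems Suc narayana_word.one_zero by (intro exI[of _ "[1, 0]"]) auto
      next
        case 3
        then have "m - narayana s < narayana l"
          using False less.prems Suc by auto
        then obtain w where "narayana_word w" "length w = l" "narayana_val w = m - narayana s"
          using less.IH[of l] Suc 3 by auto
        then show ?thesis
          using Suc 3 False narayana_word.one_zero_zero
          by (intro exI[of _ "1 # 0 # 0 # w"]) auto
      qed
    qed
  qed
qed

lemma is_narayana_rep_exists:
  assumes "m > 0"
  shows "\<exists>w. is_narayana_rep m w"
proof -
  obtain w where "narayana_word w" "narayana_val w = m"
    using narayana_word_exists[of m "Suc m"] narayana_Suc_gt[of m]
      strict_mono_imp_increasing[OF strict_mono_narayana, of m] by force
  then show ?thesis
    using assms
  \<comment> \<open>The induction strips leading zeros, which do not change the value.\<close>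
  proof (induction rule: narayana_word.induct)
    case (one_zero_zero w)
    then show ?case
      using narayana_word.one_zero_zero[of w] by (intro exI[of _ "1 # 0 # 0 # w"])
        (auto simp: is_narayana_rep_iff)
  next
    case one
    then show ?case
      using narayana_word.one by (intro exI[of _ "[1]"]) (auto simp: is_narayana_rep_iff)
  next
    case one_zero
    then show ?case
      using narayana_word.one_zero by (intro exI[of _ "[1, 0]"]) (auto simp: is_narayana_rep_iff)
  qed auto
qed

lemma is_narayana_rep_narayana_rep: "m > 0 \<Longrightarrow> is_narayana_rep m (narayana_rep m)"
  unfolding narayana_rep_def
  by (rule theI') (blast intro: is_narayana_rep_unique dest: is_narayana_rep_exists)

text \<open>A leading 0 affects neither side. A leading 100 adds a Narayana number to the value, and
  the shift identity transfers the equation from the tail.\<close>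

lemma last_narayana_word_iff:
  "narayana_word w \<Longrightarrow> w \<noteq> [] \<Longrightarrow> last w = 1 \<longleftrightarrow> H (Suc (narayana_val w)) = H (narayana_val w)"
proof (induction rule: narayana_word.induct)
  case (zero w)
  then show ?case by (cases "w = []") auto
next
  case (one_zero_zero w)
  define k where "k = Suc (Suc (length w))"
  \<comment> \<open>Strictness lets the shift identity apply to \<open>Suc (narayana_val w)\<close>
    as well.\<close>
  have le: "narayana_val w < narayana (k - 2)"
    using narayana_val_less one_zero_zero k_def by simp
  then have "H (narayana k + narayana_val w) = narayana (k - 1) + H (narayana_val w)"
    "H (narayana k + Suc (narayana_val w)) = narayana (k - 1) + H (Suc (narayana_val w))"
    by (intro H_narayana_add; simp add: k_def)+
  moreover have "narayana_val (1 # 0 # 0 # w) = narayana k + narayana_val w"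
    by (simp add: k_def)
  moreover have "last w = 1 \<longleftrightarrow> H (Suc (narayana_val w)) = H (narayana_val w)" if "w \<noteq> []"
    using one_zero_zero that by simp
  ultimately show ?case
    by (cases "w = []") (simp_all del: H.simps(2) add: H.simps(2)[of 0])
qed (auto simp: numeral_eq_Suc)

lemma last_narayana_rep_iff:
  assumes "m > 0"
  shows "last (narayana_rep m) = 1 \<longleftrightarrow> H (Suc m) = H m"
  using is_narayana_rep_narayana_rep[OF assms] last_narayana_word_iff[of "narayana_rep m"]
  unfolding is_narayana_rep_iff by metis

section \<open>Values taken twice\<close>

text \<open>Each step from \<open>i\<close> to \<open>Suc i\<close> raises exactly one of the two
  summands, by 1.\<close>

lemma H_eq_minus_card: "H i + card {j. j < i \<and> H (Suc j) = H j} = i"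
proof (induction i)
  case (Suc i)
  let ?S = "\<lambda>i. {j. j < i \<and> H (Suc j) = H j}"
  show ?case
  proof (cases "H (Suc i) = H i")
    case True
    then have "?S (Suc i) = insert i (?S i)"
      unfolding less_Suc_eq by blast
    then have "card (?S (Suc i)) = Suc (card (?S i))"
      by (simp del: H.simps)
    then show ?thesis
      using Suc True by linarith
  next
    case False
    then have "?S (Suc i) = ?S i"
      unfolding less_Suc_eq by blast
    then show ?thesis
      using Suc False H_Suc_cases[of i] by presburger
  qed
qed simp

lemma H_less_if_repeated:
  assumes "H (Suc i) = H i" "Suc i < j"
  shows "H i < H j"
proof -
  have "H (Suc (Suc i)) \<le> H j"
    using assms(2) by (intro monoD[OF mono_H]) simp
  then show ?thesis
    using H_Suc_Suc_neq[OF assms(1)] H_Suc_cases[of "Suc i"] assms(1) by (simp del: H.simps)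
qed

lemma H_fiber_repeated:
  assumes "H (Suc i) = H i"
  shows "{j. H j = H i} = {i, Suc i}"
proof -
  have "j = i \<or> j = Suc i" if "H j = H i" for j
  proof (rule ccontr)
    assume "\<not> (j = i \<or> j = Suc i)"
    then consider "Suc i < j" | "j < i" by linarith
    then show False
    proof cases
      case 1
      then show False using H_less_if_repeated[OF assms, of j] that by simp
    next
      case 2
      \<comment> \<open>Monotonicity squeezes \<open>H (Suc j)\<close>; the repetition at
        \<open>j\<close> would then extend as far as \<open>Suc i\<close>, beyond
        \<open>Suc j\<close>.\<close>
      then have "H (Suc j) = H j"
        using that monoD[OF mono_H, of j "Suc j"] monoD[OF mono_H, of "Suc j" i]
        by (simp del: H.simps)
      then have "H j < H (Suc i)" using 2 by (intro H_less_if_repeated) simp_all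
      then show False using that assms by (simp del: H.simps)
    qed
  qed
  then show ?thesis using assms by blast
qed

text \<open>By monotonicity the two arguments sharing a value are adjacent; conversely a repetition
  fills its whole fiber.\<close>

lemma twice_eq_image:
  "{k. card {i. H i = k} = 2} = H ` {i. H (Suc i) = H i}"
proof (intro equalityI subsetI)
  fix k assume "k \<in> {k. card {i. H i = k} = 2}"
  then obtain a b where ab: "{i. H i = k} = {a, b}" "a \<noteq> b"
    by (auto simp: card_2_iff)
  define i where "i = min a b"
  define j where "j = max a b"
  have "H i = k" "H j = k" "i < j"
    using ab by (auto simp: i_def j_def min_def max_def)
  then have "H (Suc i) = H i"
    using monoD[OF mono_H, of i "Suc i"] monoD[OF mono_H, of "Suc i" j]
    by (simp del: H.simps)
  then show "k \<in> H ` {i. H (Suc i) = H i}"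
    using \<open>H i = k\<close> by blast
next
  fix k assume "k \<in> H ` {i. H (Suc i) = H i}"
  then show "k \<in> {k. card {i. H i = k} = 2}"
    using H_fiber_repeated by (auto simp del: H.simps)
qed

text \<open>The shift identity copies the repetition \<open>H 1 = H 2\<close> to
  \<open>narayana k + 1\<close> for arbitrarily large \<open>k\<close>.\<close>

lemma infinite_repeated: "infinite {i. H (Suc i) = H i}"
  unfolding infinite_nat_iff_unbounded
proof
  fix m :: nat
  define k where "k = m + 3"
  have "2 \<le> narayana (k - 2)"
    using strict_mono_less_eq[OF strict_mono_narayana, of 1 "k - 2"] by (simp add: k_def)
  then have "H (narayana k + 1) = narayana (k - 1) + H 1" "H (narayana k + 2) = narayana (k - 1) + H 2"
    by (intro H_narayana_add; simp add: k_def)+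
  then have "H (Suc (narayana k + 1)) = H (narayana k + 1)"
    by (simp add: numeral_eq_Suc)
  moreover have "m < narayana k + 1"
    using strict_mono_imp_increasing[OF strict_mono_narayana, of k] by (simp add: k_def)
  ultimately show "\<exists>n>m. n \<in> {i. H (Suc i) = H i}" by blast
qed

lemma card_less_enumerate:
  fixes S :: "nat set"
  assumes "infinite S"
  shows "card {s \<in> S. s < enumerate S n} = n"
proof -
  have "{s \<in> S. s < enumerate S n} = enumerate S ` {..<n}"
    using assms enumerate_Ex[OF assms] enumerate_in_set[of S] by fastforce
  then show ?thesis
    using inj_on_subset[OF inj_enumerate[OF assms], of "{..<n}"] by (simp add: card_image)
qed

text \<open>An increasing map preserves the number of smaller elements, and this number is the index
  in the enumeration.\<close>

lemma enumerate_image: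
  fixes f :: "nat \<Rightarrow> nat"
  assumes "infinite S" "strict_mono_on S f"
  shows "enumerate (f ` S) n = f (enumerate S n)"
proof -
  have inj: "inj_on f S"
    using assms(2) by (rule strict_mono_on_imp_inj_on)
  then have inf: "infinite (f ` S)"
    using assms(1) finite_imageD by blast
  define x where "x = enumerate S n"
  have x: "x \<in> S"
    using assms(1) by (simp add: x_def enumerate_in_set)
  obtain k where k: "enumerate (f ` S) k = f x"
    using enumerate_Ex[OF inf] x by blast
  have "{t \<in> f ` S. t < f x} = f ` {s \<in> S. s < x}"
    using x strict_mono_on_less[OF assms(2)] by auto
  then have "card {t \<in> f ` S. t < f x} = card {s \<in> S. s < x}"
    by (simp add: card_image inj_on_subset[OF inj])
  then have "k = n"
    using card_less_enumerate[OF inf, of k] card_less_enumerate[OF assms(1), of n] k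
    by (simp add: x_def)
  then show ?thesis
    using k by (simp add: x_def)
qed

theorem theorem38:
  fixes n :: nat
  assumes "n \<ge> 1"
  shows "A n + n - 1 = B n"
proof -
  define S where "S = {i. H (Suc i) = H i}"
  have inf: "infinite S"
    using infinite_repeated by (simp only: S_def not_False_eq_True)
  have "m > 0" if "m \<in> S" for m
    using that by (cases m) (auto simp: S_def)
  then have "{m. m > 0 \<and> last (narayana_rep m) = 1} = S"
    using last_narayana_rep_iff by (auto simp only: S_def)
  then have B: "B n = enumerate S (n - 1)"
    by (simp add: B_def)
  \<comment> \<open>Two consecutive numbers cannot both lie in \<open>S\<close>, so \<open>j\<close>
    lies beyond the repetition at \<open>i\<close>.\<close>
  have "H i < H j" if "i \<in> S" "j \<in> S" "i < j" for i j
  proof -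
    have "j \<noteq> Suc i"
      using that H_Suc_Suc_neq[of i] by (auto simp: S_def simp del: H.simps)
    then show ?thesis
      using that H_less_if_repeated[of i j] by (auto simp: S_def simp del: H.simps)
  qed
  then have "strict_mono_on S H"
    by (intro strict_mono_onI)
  then have A: "A n = H (B n)"
    unfolding A_def twice_eq_image B S_def[symmetric] by (rule enumerate_image[OF inf])
  have "{j. j < B n \<and> H (Suc j) = H j} = {j \<in> S. j < B n}"
    by (auto simp: S_def simp del: H.simps)
  \<comment> \<open>Exactly \<open>n - 1\<close> repetitions precede \<open>B n\<close>, because the
    library enumeration starts at index 0.\<close>
  then have "H (B n) + (n - 1) = B n"
    using H_eq_minus_card[of "B n"] card_less_enumerate[OF inf, of "n - 1"] by (simp add: B)
  then show ?thesis
    using A assms by simp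
qed

end
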